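(* Let $G$ be an unbalanced split graph (considered as a labeled graph) with ABC-partition $V(G)=A\cup B\cup C$. If $G$ is an NG-1 graph, then the KS-partitions of $G$ are exactly: $K=A\cup B$, $S=C$ (which is the unique $K$-max partition), and $K=(A\cup B)\setminus\{a\}$, $S=C\cup\{a\}$ for each $a\in A$ (these are $S$-max). If $G$ is an NG-2 graph, then the KS-partitions of $G$ are exactly: $K=B$, $S=A\cup C$ (which is the unique $S$-max partition), and $K=B\cup\{a\}$, $S=(A\cup C)\setminus\{a\}$ for each $a\in A$ (these are $K$-max).
   Context: Graphs are finite and simple; $\chi,\omega,\alpha$ denote chromatic number, clique number and independence number. A graph $G$ is an NG-graph if $\chi(G)+\chi(\overline{G})=|V(G)|+1$. The ABC-partition of $V(G)$ is $A=\{v:\deg(v)=\chi(G)-1\}$, $B=\{v:\deg(v)>\chi(G)-1\}$, $C=\{v:\deg(v)<\chi(G)-1\}$. An NG-graph is NG-1 if $G[A]$ is a clique and NG-2 if $G[A]$ is a stable set. A KS-partition of a graph is a partition $V(G)=K\cup S$ with $K$ a clique and $S$ a stable set; a split graph is a graph having a KS-partition. A KS-partition is $K$-max if $|K|=\omega(G)$ and $S$-max if $|S|=\alpha(G)$. A split graph is balanced if it has a KS-partition that is both $K$-max and $S$-max, and unbalanced otherwise. *)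

theory Defs
  imports "HOL-Library.Ramsey"
begin

text \<open>
  A graph is given by its vertex set \<open>V\<close> and its edge set \<open>E\<close>, edges being two-element sets
  of vertices. Cliques and stable sets are the library notions \<open>clique\<close> and \<open>indep\<close> from
  \<open>HOL-Library.Ramsey\<close>; for \<open>X \<subseteq> V\<close>, the induced graph \<open>G[X]\<close> is complete (resp. edgeless)
  iff \<open>clique X E\<close> (resp. \<open>indep X E\<close>).
\<close>

definition fin_simple_graph :: "'a set \<Rightarrow> 'a set set \<Rightarrow> bool" where
  "fin_simple_graph V E \<longleftrightarrow> finite V \<and> E \<subseteq> [V]\<^bsup>2\<^esup>"

definition complement_edges :: "'a set \<Rightarrow> 'a set set \<Rightarrow> 'a set set" where
  "complement_edges V E = [V]\<^bsup>2\<^esup> - E"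

definition degree :: "'a set set \<Rightarrow> 'a \<Rightarrow> nat" where
  "degree E v = card {e \<in> E. v \<in> e}"

definition proper_colouring :: "'a set \<Rightarrow> 'a set set \<Rightarrow> nat \<Rightarrow> ('a \<Rightarrow> nat) \<Rightarrow> bool" where
  "proper_colouring V E k f \<longleftrightarrow>
     f ` V \<subseteq> {..<k} \<and> (\<forall>u\<in>V. \<forall>v\<in>V. {u, v} \<in> E \<longrightarrow> f u \<noteq> f v)"

definition chromatic_number :: "'a set \<Rightarrow> 'a set set \<Rightarrow> nat" where
  "chromatic_number V E = (LEAST k. \<exists>f. proper_colouring V E k f)"

definition clique_number :: "'a set \<Rightarrow> 'a set set \<Rightarrow> nat" where
  "clique_number V E = Max (card ` {K. K \<subseteq> V \<and> clique K E})"

definition independence_number :: "'a set \<Rightarrow> 'a set set \<Rightarrow> nat" where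
  "independence_number V E = Max (card ` {S. S \<subseteq> V \<and> indep S E})"

definition NG_graph :: "'a set \<Rightarrow> 'a set set \<Rightarrow> bool" where
  "NG_graph V E \<longleftrightarrow> fin_simple_graph V E \<and>
     chromatic_number V E + chromatic_number V (complement_edges V E) = card V + 1"

text \<open>
  The subtraction on \<open>nat\<close> below is never truncated: the conditions are only tested at
  vertices, and a graph with a vertex has chromatic number at least 1.
\<close>

definition part_A :: "'a set \<Rightarrow> 'a set set \<Rightarrow> 'a set" where
  "part_A V E = {v \<in> V. degree E v = chromatic_number V E - 1}"

definition part_B :: "'a set \<Rightarrow> 'a set set \<Rightarrow> 'a set" where
  "part_B V E = {v \<in> V. degree E v > chromatic_number V E - 1}"

definition part_C :: "'a set \<Rightarrow> 'a set set \<Rightarrow> 'a set" where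
  "part_C V E = {v \<in> V. degree E v < chromatic_number V E - 1}"

definition NG1_graph :: "'a set \<Rightarrow> 'a set set \<Rightarrow> bool" where
  "NG1_graph V E \<longleftrightarrow> NG_graph V E \<and> clique (part_A V E) E"

definition NG2_graph :: "'a set \<Rightarrow> 'a set set \<Rightarrow> bool" where
  "NG2_graph V E \<longleftrightarrow> NG_graph V E \<and> indep (part_A V E) E"

text \<open>
  As usual for split graphs, \<open>K\<close> or \<open>S\<close> may be empty (complete and edgeless graphs are split).
\<close>

definition KS_partition :: "'a set \<Rightarrow> 'a set set \<Rightarrow> 'a set \<Rightarrow> 'a set \<Rightarrow> bool" where
  "KS_partition V E K S \<longleftrightarrow> K \<union> S = V \<and> K \<inter> S = {} \<and> clique K E \<and> indep S E"

definition K_max_partition :: "'a set \<Rightarrow> 'a set set \<Rightarrow> 'a set \<Rightarrow> 'a set \<Rightarrow> bool" where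
  "K_max_partition V E K S \<longleftrightarrow> KS_partition V E K S \<and> card K = clique_number V E"

definition S_max_partition :: "'a set \<Rightarrow> 'a set set \<Rightarrow> 'a set \<Rightarrow> 'a set \<Rightarrow> bool" where
  "S_max_partition V E K S \<longleftrightarrow> KS_partition V E K S \<and> card S = independence_number V E"

definition split_graph :: "'a set \<Rightarrow> 'a set set \<Rightarrow> bool" where
  "split_graph V E \<longleftrightarrow> fin_simple_graph V E \<and> (\<exists>K S. KS_partition V E K S)"

definition balanced_split_graph :: "'a set \<Rightarrow> 'a set set \<Rightarrow> bool" where
  "balanced_split_graph V E \<longleftrightarrow> split_graph V E \<and>
     (\<exists>K S. K_max_partition V E K S \<and> S_max_partition V E K S)"

definition unbalanced_split_graph :: "'a set \<Rightarrow> 'a set set \<Rightarrow> bool" where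
  "unbalanced_split_graph V E \<longleftrightarrow> split_graph V E \<and> \<not> balanced_split_graph V E"

end

theory Submission
  imports Defs
begin

text \<open>
  Let \<open>(K, S)\<close> be a KS-partition of an unbalanced split graph. If \<open>K\<close> is not maximum, a larger
  clique can only be \<open>K\<close> with one vertex of \<open>S\<close> added; if \<open>S\<close> is not maximum, a larger stable set
  can only be \<open>S\<close> with one vertex of \<open>K\<close> added. In both cases \<open>V\<close> splits as \<open>Q \<union> I \<union> {s}\<close> such that
  \<open>Q \<union> {s}\<close> is a clique and \<open>I \<union> {s}\<close> is stable, whence
  \<open>\<chi> = \<omega> = |Q| + 1\<close> and \<open>\<alpha> = |I| + 1\<close>. Degrees are at least \<open>|Q|\<close> on \<open>Q\<close>, equal to \<open>|Q|\<close> at \<open>s\<close>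
  and at most \<open>|Q|\<close> on \<open>I\<close>; so \<open>A\<close> consists of \<open>s\<close>, the vertices of \<open>Q\<close> without neighbours
  in \<open>I\<close> and the vertices of \<open>I\<close> adjacent to all of \<open>Q\<close>. These are exactly the vertices that can be
  moved when passing to another KS-partition. As \<open>s\<close> is adjacent to all of \<open>Q\<close> and to nothing in
  \<open>I\<close>, being NG-1 forces \<open>A \<inter> I = {}\<close> and being NG-2 forces \<open>A \<inter> Q = {}\<close>.
\<close>

section \<open>Degrees, extremal cliques and stable sets\<close>

lemma degree_eq_card_neighbours:
  assumes "fin_simple_graph V E"
  shows "degree E v = card {u \<in> V. {u, v} \<in> E}"
proof -
  have "bij_betw (\<lambda>u. {u, v}) {u \<in> V. {u, v} \<in> E} {e \<in> E. v \<in> e}"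
  proof (rule bij_betw_imageI)
    show "inj_on (\<lambda>u. {u, v}) {u \<in> V. {u, v} \<in> E}"
      by (auto simp: inj_on_def doubleton_eq_iff)
    show "(\<lambda>u. {u, v}) ` {u \<in> V. {u, v} \<in> E} = {e \<in> E. v \<in> e}"
    proof (intro equalityI subsetI)
      fix e assume e: "e \<in> {e \<in> E. v \<in> e}"
      then have "e \<in> [V]\<^bsup>2\<^esup>"
        using assms by (auto simp: fin_simple_graph_def)
      then obtain x y where "e = {x, y}" "x \<in> V" "y \<in> V" "x \<noteq> y"
        by (auto simp: nsets_def card_2_iff)
      with e show "e \<in> (\<lambda>u. {u, v}) ` {u \<in> V. {u, v} \<in> E}"
        by (auto simp: insert_commute)
    qed auto
  qed
  then show ?thesis
    by (simp add: degree_def bij_betw_same_card)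
qed

lemma card_clique_le_clique_number:
  assumes "finite V" "K \<subseteq> V" "clique K E"
  shows "card K \<le> clique_number V E"
  unfolding clique_number_def using assms by (intro Max_ge) auto

lemma card_indep_le_independence_number:
  assumes "finite V" "S \<subseteq> V" "indep S E"
  shows "card S \<le> independence_number V E"
  unfolding independence_number_def using assms by (intro Max_ge) auto

lemma clique_number_attained:
  assumes "finite V"
  obtains K where "K \<subseteq> V" "clique K E" "card K = clique_number V E"
proof -
  have "clique_number V E \<in> card ` {K. K \<subseteq> V \<and> clique K E}"
    unfolding clique_number_def using assms
    by (intro Max_in) (auto simp: clique_def intro!: exI[of _ "{}"])
  then show ?thesis
    using that by auto
qed

lemma independence_number_attained:
  assumes "finite V"
  obtains S where "S \<subseteq> V" "indep S E" "card S = independence_number V E"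
proof -
  have "independence_number V E \<in> card ` {S. S \<subseteq> V \<and> indep S E}"
    unfolding independence_number_def using assms
    by (intro Max_in) (auto simp: indep_def intro!: exI[of _ "{}"])
  then show ?thesis
    using that by auto
qed

text \<open>Two distinct common vertices would have to be both adjacent and non-adjacent.\<close>

lemma clique_Int_indep:
  assumes "clique K E" "indep S E" "x \<in> K \<inter> S" "y \<in> K \<inter> S"
  shows "x = y"
  using assms by (auto simp: clique_def indep_def)

text \<open>As at most one element of \<open>Y\<close> lies outside \<open>X\<close>, being larger
  forces \<open>Y\<close> to contain all of \<open>X\<close> and one further element. Used with
  \<open>X\<close> a side of a KS-partition and \<open>Y\<close> a maximum clique or stable
  set.\<close>

lemma subset_insert_card_less:
  assumes "finite X" "finite Y" "card X < card Y"
    and "\<And>x y. x \<in> Y - X \<Longrightarrow> y \<in> Y - X \<Longrightarrow> x = y"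
  obtains b where "b \<notin> X" "Y = insert b X"
proof -
  obtain b where b: "b \<in> Y" "b \<notin> X"
    using assms(1,3) by (meson card_mono leD subsetI)
  with assms(4) have "Y \<subseteq> insert b X"
    by blast
  moreover have "card (insert b X) \<le> card Y"
    using assms(1,3) b by simp
  ultimately have "Y = insert b X"
    using assms(1) by (intro card_seteq) auto
  with b that show ?thesis
    by blast
qed

section \<open>Unbalanced split graphs and swing vertices\<close>

locale swing_partition =
  fixes V :: "'a set" and E :: "'a set set" and Q I :: "'a set" and s :: 'a
  assumes graph: "fin_simple_graph V E"
    and V_eq: "V = insert s (Q \<union> I)"
    and s_notin: "s \<notin> Q" "s \<notin> I"
    and disjoint: "Q \<inter> I = {}"
    and clique_Q: "clique (insert s Q) E"
    and indep_I: "indep (insert s I) E"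

lemma unbalanced_split_graph_swing_partition:
  assumes "unbalanced_split_graph V E"
  obtains Q I s where "swing_partition V E Q I s"
proof -
  obtain K S where KS: "KS_partition V E K S" and G: "fin_simple_graph V E"
    using assms by (auto simp: unbalanced_split_graph_def split_graph_def)
  then have fin: "finite V" "finite K" "finite S" and V: "V = K \<union> S" "K \<inter> S = {}"
    and K: "clique K E" and S: "indep S E"
    by (auto simp: fin_simple_graph_def KS_partition_def)
  have "card K \<noteq> clique_number V E \<or> card S \<noteq> independence_number V E"
    using assms KS unfolding unbalanced_split_graph_def balanced_split_graph_def
      K_max_partition_def S_max_partition_def by blast
  then consider "card K < clique_number V E" | "card S < independence_number V E"
    using card_clique_le_clique_number[OF fin(1) _ K] card_indep_le_independence_number[OF fin(1) _ S]
      V(1) by fastforce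
  then show ?thesis
  proof cases
    case 1
    obtain K' where K': "K' \<subseteq> V" "clique K' E" "card K' = clique_number V E"
      using clique_number_attained[OF fin(1)] .
    \<comment> \<open>\<open>K' - K\<close> lies in the stable set \<open>S\<close>, so the clique
      \<open>K'\<close> has at most one vertex there.\<close>
    have "x = y" if "x \<in> K' - K" "y \<in> K' - K" for x y
      using clique_Int_indep[OF K'(2) S, of x y] that K'(1) V(1) by blast
    then obtain b where b: "b \<notin> K" "K' = insert b K"
      using subset_insert_card_less[of K K'] fin K' 1 by (metis finite_subset)
    \<comment> \<open>The vertex \<open>b\<close> comes from \<open>S\<close>: putting it back into
      \<open>S - {b}\<close> gives \<open>S\<close>, adding it to \<open>K\<close> gives
      \<open>K'\<close>.\<close>
    have "swing_partition V E K (S - {b}) b"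
      using b K' V G S by unfold_locales (auto simp: indep_def)
    then show ?thesis
      by (rule that)
  next
    case 2
    obtain S' where S': "S' \<subseteq> V" "indep S' E" "card S' = independence_number V E"
      using independence_number_attained[OF fin(1)] .
    have "x = y" if "x \<in> S' - S" "y \<in> S' - S" for x y
      using clique_Int_indep[OF K S'(2), of x y] that S'(1) V(1) by blast
    then obtain b where b: "b \<notin> S" "S' = insert b S"
      using subset_insert_card_less[of S S'] fin S' 2 by (metis finite_subset)
    have "swing_partition V E (K - {b}) S b"
      using b S' V G K by unfold_locales (auto simp: clique_def)
    then show ?thesis
      by (rule that)
  qed
qed

context swing_partition
begin

section \<open>Clique, independence and chromatic numbers\<close>

lemma finite_parts: "finite V" "finite Q" "finite I"
  using graph V_eq by (auto simp: fin_simple_graph_def)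

lemma in_V_iff: "v \<in> V \<longleftrightarrow> v = s \<or> v \<in> Q \<or> v \<in> I"
  using V_eq by auto

lemma no_loop: "{v} \<notin> E"
  using graph by (auto simp: fin_simple_graph_def nsets_def)

lemma clique_number_eq: "clique_number V E = Suc (card Q)"
proof (rule antisym)
  obtain K where K: "K \<subseteq> V" "clique K E" "card K = clique_number V E"
    using clique_number_attained[OF finite_parts(1)] .
  have "K \<inter> insert s I \<subseteq> {x}" if "x \<in> K \<inter> insert s I" for x
    using clique_Int_indep[OF K(2) indep_I that] by blast
  \<comment> \<open>If the intersection is empty, any \<open>x\<close> serves.\<close>
  then obtain x where "K \<inter> insert s I \<subseteq> {x}"
    by blast
  then have "K \<subseteq> insert x Q"
    using K(1) V_eq by blast
  then have "card K \<le> card (insert x Q)"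
    using finite_parts by (intro card_mono) auto
  also have "\<dots> \<le> Suc (card Q)"
    by (rule card_insert_le_m1) auto
  finally show "clique_number V E \<le> Suc (card Q)"
    using K(3) by simp
  show "Suc (card Q) \<le> clique_number V E"
    using card_clique_le_clique_number[OF finite_parts(1) _ clique_Q] V_eq s_notin finite_parts
    by auto
qed

lemma independence_number_eq: "independence_number V E = Suc (card I)"
proof (rule antisym)
  obtain S where S: "S \<subseteq> V" "indep S E" "card S = independence_number V E"
    using independence_number_attained[OF finite_parts(1)] .
  have "insert s Q \<inter> S \<subseteq> {x}" if "x \<in> insert s Q \<inter> S" for x
    using clique_Int_indep[OF clique_Q S(2) that] by blast
  then obtain x where "insert s Q \<inter> S \<subseteq> {x}"
    by blast
  then have "S \<subseteq> insert x I"
    using S(1) V_eq by blast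
  then have "card S \<le> card (insert x I)"
    using finite_parts by (intro card_mono) auto
  also have "\<dots> \<le> Suc (card I)"
    by (rule card_insert_le_m1) auto
  finally show "independence_number V E \<le> Suc (card I)"
    using S(3) by simp
  show "Suc (card I) \<le> independence_number V E"
    using card_indep_le_independence_number[OF finite_parts(1) _ indep_I] V_eq s_notin finite_parts
    by auto
qed

lemma chromatic_number_eq: "chromatic_number V E = Suc (card Q)"
  unfolding chromatic_number_def
proof (rule Least_equality)
  have "card (insert s Q) = Suc (card Q)"
    using finite_parts s_notin by simp
  then obtain h where h: "bij_betw h (insert s Q) {..<Suc (card Q)}"
    using finite_parts ex_bij_betw_finite_nat[of "insert s Q"] by (auto simp: atLeast0LessThan)
  \<comment> \<open>The clique \<open>insert s Q\<close> gets distinct colours; all of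
    \<open>I\<close> reuses the colour of \<open>s\<close>, which is safe because
    \<open>insert s I\<close> is stable.\<close>
  have "proper_colouring V E (Suc (card Q)) (\<lambda>v. if v \<in> I then h s else h v)"
    (is "proper_colouring _ _ _ ?f")
    unfolding proper_colouring_def
  proof (intro conjI ballI impI)
    show "?f ` V \<subseteq> {..<Suc (card Q)}"
      using bij_betw_imp_surj_on[OF h] V_eq by auto
  next
    fix u v assume uv: "u \<in> V" "v \<in> V" "{u, v} \<in> E"
    then have "u \<noteq> v"
      using no_loop by auto
    moreover have "\<not> (u \<in> insert s I \<and> v \<in> insert s I)"
      using uv(3) indep_I \<open>u \<noteq> v\<close> by (auto simp: indep_def)
    ultimately show "?f u \<noteq> ?f v"
      using uv V_eq disjoint s_notin inj_on_eq_iff[OF bij_betw_imp_inj_on[OF h]]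
      by auto
  qed
  then show "\<exists>f. proper_colouring V E (Suc (card Q)) f"
    by blast
next
  fix k assume "\<exists>f. proper_colouring V E k f"
  then obtain f where f: "proper_colouring V E k f"
    by blast
  \<comment> \<open>Adjacent vertices differ in colour, so a clique bounds the number of colours
    from below.\<close>
  have "inj_on f (insert s Q)"
    using f V_eq clique_Q unfolding proper_colouring_def inj_on_def clique_def by blast
  moreover have "f ` insert s Q \<subseteq> {..<k}"
    using f V_eq unfolding proper_colouring_def by blast
  ultimately have "card (insert s Q) \<le> card {..<k}"
    by (metis card_inj_on_le finite_lessThan)
  then show "Suc (card Q) \<le> k"
    using finite_parts s_notin by simp
qed

section \<open>The ABC-partition in terms of \<open>Q\<close>, \<open>I\<close> and
  \<open>s\<close>\<close>

abbreviation "A \<equiv> part_A V E"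
abbreviation "B \<equiv> part_B V E"
abbreviation "C \<equiv> part_C V E"

lemma ABC_degree:
  "A = {v \<in> V. degree E v = card Q}"
  "B = {v \<in> V. degree E v > card Q}"
  "C = {v \<in> V. degree E v < card Q}"
  by (simp_all add: part_A_def part_B_def part_C_def chromatic_number_eq)

lemma neighbours_Q:
  assumes "v \<in> insert s Q"
  shows "{u \<in> V. {u, v} \<in> E} = (insert s Q - {v}) \<union> {u \<in> I. {u, v} \<in> E}"
  using assms clique_Q V_eq no_loop by (auto simp: clique_def)

text \<open>The vertex \<open>v\<close> sees the \<open>card Q\<close> other members of the clique
  \<open>insert s Q\<close>; every further neighbour lies in \<open>I\<close>.\<close>

lemma degree_Q:
  assumes "v \<in> insert s Q"
  shows "degree E v = card Q + card {u \<in> I. {u, v} \<in> E}"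
proof -
  have "card ((insert s Q - {v}) \<union> {u \<in> I. {u, v} \<in> E}) =
      card (insert s Q - {v}) + card {u \<in> I. {u, v} \<in> E}"
    using disjoint s_notin finite_parts by (intro card_Un_disjoint) auto
  then show ?thesis
    using assms s_notin finite_parts
    by (simp add: degree_eq_card_neighbours[OF graph] neighbours_Q[OF assms] del: insert_iff)
qed

lemma degree_I:
  assumes "v \<in> I"
  shows "degree E v = card {u \<in> Q. {u, v} \<in> E}"
proof -
  have "{u, v} \<notin> E" if "u \<in> insert s I" for u
    using that assms indep_I no_loop by (cases "u = v") (auto simp: indep_def)
  then have "{u \<in> V. {u, v} \<in> E} = {u \<in> Q. {u, v} \<in> E}"
    using V_eq by auto
  then show ?thesis
    by (simp add: degree_eq_card_neighbours[OF graph])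
qed

lemma s_in_A: "s \<in> A"
proof -
  have none: "{u \<in> I. {u, s} \<in> E} = {}"
    using indep_I s_notin by (auto simp: indep_def)
  show ?thesis
    using degree_Q[of s] unfolding none by (simp add: ABC_degree in_V_iff)
qed

text \<open>By \<open>degree_Q\<close>, the degree is \<open>card Q\<close> exactly when
  \<open>v\<close> has no neighbour in \<open>I\<close>, that is, when \<open>v\<close> can join the
  stable side.\<close>

lemma in_A_iff_indep:
  assumes "v \<in> insert s Q"
  shows "v \<in> A \<longleftrightarrow> indep (insert v I) E"
proof -
  have "v \<notin> I" "v \<in> V"
    using assms disjoint s_notin V_eq by auto
  moreover have "indep I E"
    using indep_I by (auto simp: indep_def)
  ultimately show ?thesis
    using degree_Q[OF assms] finite_parts
    by (auto simp: ABC_degree indep_def insert_commute)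
qed

text \<open>A vertex of \<open>I\<close> has neighbours only in \<open>Q\<close>, so degree
  \<open>card Q\<close> means adjacency to all of \<open>Q\<close>. The vertex \<open>s\<close> is
  treated apart, since \<open>degree_I\<close> does not cover it.\<close>

lemma in_A_iff_clique:
  assumes "v \<in> insert s I"
  shows "v \<in> A \<longleftrightarrow> clique (insert v Q) E"
proof (cases "v = s")
  case True
  then show ?thesis
    using s_in_A clique_Q by simp
next
  case False
  then have v: "v \<in> I" "v \<in> V" "v \<notin> Q"
    using assms V_eq disjoint by auto
  have "clique Q E"
    using clique_Q by (auto simp: clique_def)
  then have "clique (insert v Q) E \<longleftrightarrow> {u \<in> Q. {u, v} \<in> E} = Q"
    using v by (auto simp: clique_def insert_commute)
  also have "\<dots> \<longleftrightarrow> card {u \<in> Q. {u, v} \<in> E} = card Q"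
    using card_subset_eq[OF finite_parts(2), of "{u \<in> Q. {u, v} \<in> E}"] by auto
  finally show ?thesis
    using v by (simp add: ABC_degree degree_I)
qed

lemma B_subset: "B \<subseteq> Q"
proof
  fix v assume v: "v \<in> B"
  have "v \<notin> I"
  proof
    assume "v \<in> I"
    moreover have "card {u \<in> Q. {u, v} \<in> E} \<le> card Q"
      using finite_parts by (intro card_mono) auto
    ultimately show False
      using v by (simp add: ABC_degree degree_I)
  qed
  moreover have "v \<noteq> s"
    using v s_in_A by (auto simp: ABC_degree)
  ultimately show "v \<in> Q"
    using v by (auto simp: ABC_degree in_V_iff)
qed

lemma C_subset: "C \<subseteq> I"
  using degree_Q by (auto simp: ABC_degree in_V_iff)

lemma ABC_cover: "V = A \<union> B \<union> C"
  by (auto simp: ABC_degree)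

section \<open>Classification of the KS-partitions\<close>

lemma KS_partition_iff:
  "KS_partition V E K S \<longleftrightarrow>
     (\<exists>a\<in>A \<inter> insert s Q. K = insert s Q - {a} \<and> S = insert a I) \<or>
     (\<exists>a\<in>A \<inter> insert s I. K = insert a Q \<and> S = insert s I - {a})"
  (is "?L \<longleftrightarrow> ?R1 \<or> ?R2")
proof
  assume ?L
  then have KS: "K \<union> S = V" "K \<inter> S = {}" "clique K E" "indep S E"
    by (auto simp: KS_partition_def)
  show "?R1 \<or> ?R2"
  \<comment> \<open>With \<open>s\<close> in \<open>K\<close>, no vertex of \<open>I\<close> is in
    \<open>K\<close>, so at most one vertex leaves \<open>insert s Q\<close>; with \<open>s\<close>
    in \<open>S\<close>, dually, at most one vertex joins \<open>Q\<close>.\<close>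
  proof (cases "s \<in> K")
    case True
    then have "K \<inter> I = {}"
      using clique_Int_indep[OF KS(3) indep_I, of s] s_notin by blast
    then have IS: "I \<subseteq> S" "K \<subseteq> insert s Q"
      using KS(1) V_eq by auto
    show ?thesis
    proof (cases "S = I")
      case True
      \<comment> \<open>This is the member \<open>a = s\<close> of the second family.\<close>
      then have "K = insert s Q \<and> S = insert s I - {s}"
        using KS V_eq s_notin disjoint by auto
      then show ?thesis
        using s_in_A by blast
    next
      case False
      then obtain a where a: "a \<in> S" "a \<notin> I"
        using IS by blast
      then have aQ: "a \<in> insert s Q"
        using KS(1) V_eq by auto
      \<comment> \<open>The clique \<open>insert s Q\<close> and the stable set \<open>S\<close>
        share only \<open>a\<close>, so \<open>a\<close> is the only vertex to have changed
        sides.\<close>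
      then have "insert s Q \<inter> S = {a}"
        using clique_Int_indep[OF clique_Q KS(4), of a] a by blast
      then have eq: "K = insert s Q - {a}" "S = insert a I"
        using KS V_eq IS disjoint s_notin by auto
      then have "a \<in> A"
        using in_A_iff_indep[OF aQ] KS(4) by simp
      then show ?thesis
        using eq aQ by blast
    qed
  next
    case False
    then have "s \<in> S"
      using KS(1) V_eq by auto
    then have "S \<inter> Q = {}"
      using clique_Int_indep[OF clique_Q KS(4), of s] s_notin by blast
    then have QK: "Q \<subseteq> K" "S \<subseteq> insert s I"
      using KS(1) V_eq by auto
    show ?thesis
    proof (cases "K = Q")
      case True
      \<comment> \<open>This is the member \<open>a = s\<close> of the first family.\<close>
      then have "K = insert s Q - {s} \<and> S = insert s I"
        using KS V_eq s_notin disjoint by auto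
      then show ?thesis
        using s_in_A by blast
    next
      case False
      then obtain a where a: "a \<in> K" "a \<notin> Q"
        using QK by blast
      then have aI: "a \<in> insert s I"
        using KS(1) V_eq by auto
      then have "K \<inter> insert s I = {a}"
        using clique_Int_indep[OF KS(3) indep_I, of a] a by blast
      then have eq: "K = insert a Q" "S = insert s I - {a}"
        using KS V_eq QK disjoint s_notin by auto
      then have "a \<in> A"
        using in_A_iff_clique[OF aI] KS(3) by simp
      then show ?thesis
        using eq aI by blast
    qed
  qed
next
  assume "?R1 \<or> ?R2"
  then show ?L
  proof
    assume ?R1
    then obtain a where a: "a \<in> A" "a \<in> insert s Q" "K = insert s Q - {a}" "S = insert a I"
      by blast
    moreover have "indep S E"
      using a in_A_iff_indep by simp
    moreover have "clique K E"
      using clique_Q a(3) by (auto simp: clique_def)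
    ultimately show ?L
      using V_eq disjoint s_notin by (auto simp: KS_partition_def)
  next
    assume ?R2
    then obtain a where a: "a \<in> A" "a \<in> insert s I" "K = insert a Q" "S = insert s I - {a}"
      by blast
    moreover have "clique K E"
      using a in_A_iff_clique by simp
    moreover have "indep S E"
      using indep_I a(4) by (auto simp: indep_def)
    ultimately show ?L
      using V_eq disjoint s_notin by (auto simp: KS_partition_def)
  qed
qed

section \<open>The NG-1 and NG-2 cases\<close>

text \<open>The clique \<open>A\<close> already meets the stable set \<open>insert s I\<close> in
  \<open>s\<close>, so it misses \<open>I\<close>; the inclusions of \<open>B\<close> in
  \<open>Q\<close> and \<open>C\<close> in \<open>I\<close> then determine the rest.\<close>

lemma clique_A_partition:
  assumes "clique A E"
  shows "A \<inter> I = {}" "A \<union> B = insert s Q" "C = I"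
proof -
  show A: "A \<inter> I = {}"
    using clique_Int_indep[OF assms indep_I, of s] s_in_A s_notin by blast
  then show "A \<union> B = insert s Q" "C = I"
    using B_subset C_subset ABC_cover V_eq s_in_A disjoint s_notin by blast+
qed

lemma indep_A_partition:
  assumes "indep A E"
  shows "A \<inter> Q = {}" "B = Q" "A \<union> C = insert s I"
proof -
  show A: "A \<inter> Q = {}"
    using clique_Int_indep[OF clique_Q assms, of s] s_in_A s_notin by blast
  then show "B = Q" "A \<union> C = insert s I"
    using B_subset C_subset ABC_cover V_eq s_in_A disjoint s_notin by blast+
qed

lemma KS_partitions_clique_A:
  assumes "clique A E"
  shows "KS_partition V E K S \<longleftrightarrow>
    K = A \<union> B \<and> S = C \<or> (\<exists>a\<in>A. K = A \<union> B - {a} \<and> S = C \<union> {a})"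
proof -
  \<comment> \<open>The second family shrinks to \<open>a = s\<close>, which is the partition with
    sides \<open>A \<union> B\<close> and \<open>C\<close>; the first family runs over all of
    \<open>A\<close>.\<close>
  have "A \<inter> insert s Q = A" "A \<inter> insert s I = {s}"
    using clique_A_partition[OF assms] s_in_A by auto
  then show ?thesis
    using clique_A_partition(2,3)[OF assms] s_notin by (auto simp: KS_partition_iff)
qed

lemma KS_partitions_indep_A:
  assumes "indep A E"
  shows "KS_partition V E K S \<longleftrightarrow>
    K = B \<and> S = A \<union> C \<or> (\<exists>a\<in>A. K = B \<union> {a} \<and> S = A \<union> C - {a})"
proof -
  \<comment> \<open>Now the first family shrinks to \<open>a = s\<close>, with sides
    \<open>B\<close> and \<open>A \<union> C\<close>, and the second runs over all of
    \<open>A\<close>.\<close>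
  have "A \<inter> insert s Q = {s}" "A \<inter> insert s I = A"
    using indep_A_partition[OF assms] s_in_A by auto
  then show ?thesis
    using indep_A_partition(2,3)[OF assms] s_notin by (auto simp: KS_partition_iff)
qed

text \<open>\<open>A \<union> B\<close> is the maximum clique \<open>insert s Q\<close>; in every
  other KS-partition the clique side has lost a vertex of \<open>A\<close>.\<close>

lemma K_max_partitions_clique_A:
  assumes "clique A E"
  shows "K_max_partition V E K S \<longleftrightarrow> K = A \<union> B \<and> S = C"
proof -
  have "card (A \<union> B) = clique_number V E"
    using clique_A_partition(2)[OF assms] s_notin finite_parts by (simp add: clique_number_eq)
  moreover have "card (A \<union> B - {a}) < card (A \<union> B)" if "a \<in> A" for a
    using that clique_A_partition(2)[OF assms] finite_parts by (intro card_Diff1_less) auto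
  ultimately show ?thesis
    unfolding K_max_partition_def KS_partitions_clique_A[OF assms] by fastforce
qed

lemma S_max_partition_clique_A:
  assumes "clique A E" "a \<in> A"
  shows "S_max_partition V E (A \<union> B - {a}) (C \<union> {a})"
proof -
  \<comment> \<open>Since \<open>C = I\<close> and \<open>a\<close> is not in \<open>I\<close>, the
    size is \<open>Suc (card I)\<close>.\<close>
  have "card (C \<union> {a}) = independence_number V E"
    using clique_A_partition[OF assms(1)] assms(2) finite_parts
    by (auto simp: independence_number_eq card_insert_if)
  then show ?thesis
    using assms by (auto simp: S_max_partition_def KS_partitions_clique_A)
qed

lemma S_max_partitions_indep_A:
  assumes "indep A E"
  shows "S_max_partition V E K S \<longleftrightarrow> K = B \<and> S = A \<union> C"
proof -
  have "card (A \<union> C) = independence_number V E"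
    using indep_A_partition(3)[OF assms] s_notin finite_parts by (simp add: independence_number_eq)
  moreover have "card (A \<union> C - {a}) < card (A \<union> C)" if "a \<in> A" for a
    using that indep_A_partition(3)[OF assms] finite_parts by (intro card_Diff1_less) auto
  ultimately show ?thesis
    unfolding S_max_partition_def KS_partitions_indep_A[OF assms] by fastforce
qed

lemma K_max_partition_indep_A:
  assumes "indep A E" "a \<in> A"
  shows "K_max_partition V E (B \<union> {a}) (A \<union> C - {a})"
proof -
  have "card (B \<union> {a}) = clique_number V E"
    using indep_A_partition[OF assms(1)] assms(2) finite_parts
    by (auto simp: clique_number_eq card_insert_if)
  then show ?thesis
    using assms by (auto simp: K_max_partition_def KS_partitions_indep_A)
qed

end

theorem theorem2p5:
  fixes V :: "'a set" and E :: "'a set set" and A B C :: "'a set"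
  assumes "unbalanced_split_graph V E"
    and "A = part_A V E" and "B = part_B V E" and "C = part_C V E"
  shows
    "(NG1_graph V E \<longrightarrow>
        {(K, S). KS_partition V E K S} =
          {(A \<union> B, C)} \<union> {((A \<union> B) - {a}, C \<union> {a}) | a. a \<in> A} \<and>
        {(K, S). K_max_partition V E K S} = {(A \<union> B, C)} \<and>
        (\<forall>a\<in>A. S_max_partition V E ((A \<union> B) - {a}) (C \<union> {a}))) \<and>
     (NG2_graph V E \<longrightarrow>
        {(K, S). KS_partition V E K S} =
          {(B, A \<union> C)} \<union> {(B \<union> {a}, (A \<union> C) - {a}) | a. a \<in> A} \<and>
        {(K, S). S_max_partition V E K S} = {(B, A \<union> C)} \<and>
        (\<forall>a\<in>A. K_max_partition V E (B \<union> {a}) ((A \<union> C) - {a})))"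
proof -
  obtain Q I s where "swing_partition V E Q I s"
    using unbalanced_split_graph_swing_partition[OF assms(1)] .
  \<comment> \<open>The conclusion does not mention \<open>Q\<close>, \<open>I\<close> or
    \<open>s\<close>, so any choice of them will do.\<close>
  then interpret swing_partition V E Q I s .
  show ?thesis
    unfolding NG1_graph_def NG2_graph_def assms(2-4)
    by (auto simp: KS_partitions_clique_A KS_partitions_indep_A K_max_partitions_clique_A
        S_max_partitions_indep_A S_max_partition_clique_A[simplified] K_max_partition_indep_A[simplified])
qed

end
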